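(* Under the projective change of coordinates $\mathbb{RP}^2\to\mathbb{RP}^2$ given by $[a:b:c]=\left[\tfrac{w+u}{2}:v:\tfrac{w-u}{2}\right]$, the set $\{[a:b:c]\mid b^2<4ac\}$ corresponds to the Klein disk $\{[u:v:1]\mid u^2+v^2<1\}$, and the quadratic formula $[a:b:c]\mapsto \frac{-b\pm i\sqrt{4ac-b^2}}{2a}$ becomes the map $$[u:v:1]\mapsto \frac{-v\pm i\sqrt{1-u^2-v^2}}{1+u},$$ which (taking the root with positive imaginary part) is precisely the usual isometry from the Klein disk model of the hyperbolic plane to the upper half plane model.
   Context: The Klein disk model is the open unit disk $\{(u,v)\mid u^2+v^2<1\}$ with distance $d((u_1,v_1),(u_2,v_2))=\operatorname{arcosh}\frac{1-u_1u_2-v_1v_2}{\sqrt{(1-u_1^2-v_1^2)(1-u_2^2-v_2^2)}}$. The upper half plane model is $\{x+iy\mid y>0\}$ with distance $\operatorname{arcosh}\left(1+\frac{(x_2-x_1)^2+(y_2-y_1)^2}{2y_1y_2}\right)$. *)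

theory Defs
  imports "HOL-Analysis.Analysis"
begin

text \<open>The real projective plane: nonzero triples of reals up to a nonzero scalar.\<close>

definition proj_rel :: "real \<times> real \<times> real \<Rightarrow> real \<times> real \<times> real \<Rightarrow> bool" where
  "proj_rel x y \<longleftrightarrow> x \<noteq> 0 \<and> y \<noteq> 0 \<and> (\<exists>k. k \<noteq> 0 \<and> y = k *\<^sub>R x)"

lemma part_equivp_proj_rel: "part_equivp proj_rel"
proof (rule part_equivpI)
  show "\<exists>x. proj_rel x x"
    by (rule exI[of _ "(1, 0, 0)"]) (auto simp: proj_rel_def zero_prod_def intro!: exI[of _ 1])
  show "symp proj_rel"
  proof (rule sympI)
    fix x y assume "proj_rel x y"
    then obtain k where "x \<noteq> 0" "y \<noteq> 0" "k \<noteq> 0" "y = k *\<^sub>R x"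
      by (auto simp: proj_rel_def)
    then show "proj_rel y x"
      by (auto simp: proj_rel_def intro!: exI[of _ "inverse k"])
  qed
  show "transp proj_rel"
  proof (rule transpI)
    fix x y z assume "proj_rel x y" "proj_rel y z"
    then obtain k l where "x \<noteq> 0" "z \<noteq> 0" "k \<noteq> 0" "l \<noteq> 0" "y = k *\<^sub>R x" "z = l *\<^sub>R y"
      by (auto simp: proj_rel_def)
    then show "proj_rel x z"
      by (auto simp: proj_rel_def intro!: exI[of _ "l * k"])
  qed
qed

quotient_type rp2 = "real \<times> real \<times> real" / partial: proj_rel
  by (rule part_equivp_proj_rel)

text \<open>The point with homogeneous coordinates \<open>[a : b : c]\<close>; unspecified if all three are zero.\<close>

definition hpoint :: "real \<Rightarrow> real \<Rightarrow> real \<Rightarrow> rp2" where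
  "hpoint a b c = abs_rp2 (a, b, c)"

text \<open>The new coordinates \<open>[u : v : w]\<close> are sent to the old coordinates \<open>[a : b : c]\<close>.\<close>

lift_definition coord_change :: "rp2 \<Rightarrow> rp2" is
  "\<lambda>(u, v, w). ((w + u) / 2, v, (w - u) / 2)"
  by (auto simp: proj_rel_def zero_prod_def field_simps)

text \<open>
  The sign of the root is not invariant under rescaling \<open>(a, b, c)\<close> by a negative number, so
  the quadratic formula is a function on the projective plane only as a map to the set of the
  two values. It is meaningful where \<open>b\<^sup>2 < 4 * a * c\<close>.
\<close>

lift_definition quadratic_formula :: "rp2 \<Rightarrow> complex set" is
  "\<lambda>(a, b, c). {(- of_real b + \<i> * of_real (sqrt (4 * a * c - b\<^sup>2))) / of_real (2 * a),
                (- of_real b - \<i> * of_real (sqrt (4 * a * c - b\<^sup>2))) / of_real (2 * a)}"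
proof -
  fix x y :: "real \<times> real \<times> real"
  assume "proj_rel x y"
  then obtain k where k: "k \<noteq> 0" "y = k *\<^sub>R x"
    by (auto simp: proj_rel_def)
  obtain a b c where x: "x = (a, b, c)"
    by (cases x) auto
  define s :: complex where "s = \<i> * of_real (sqrt (4 * a * c - b\<^sup>2))"
  have "4 * (k * a) * (k * c) - (k * b)\<^sup>2 = k\<^sup>2 * (4 * a * c - b\<^sup>2)"
    by (simp add: power2_eq_square algebra_simps)
  then have "sqrt (4 * (k * a) * (k * c) - (k * b)\<^sup>2) = \<bar>k\<bar> * sqrt (4 * a * c - b\<^sup>2)"
    by (simp add: real_sqrt_mult)
  then have s': "\<i> * of_real (sqrt (4 * (k * a) * (k * c) - (k * b)\<^sup>2)) = of_real \<bar>k\<bar> * s"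
    by (simp add: s_def)
  have cancel: "(- of_real (k * b) + of_real k * t) / of_real (2 * (k * a))
      = (- of_real b + t) / (of_real (2 * a) :: complex)" for t
  proof -
    have "- of_real (k * b) + of_real k * t = of_real k * (- of_real b + t)"
      by (simp add: algebra_simps)
    moreover have "of_real (2 * (k * a)) = (of_real k * of_real (2 * a) :: complex)"
      by simp
    ultimately show ?thesis
      using k by (simp only: mult_divide_mult_cancel_left of_real_eq_0_iff if_False not_False_eq_True)
  qed
  have cancel': "(- of_real (k * b) - of_real k * t) / of_real (2 * (k * a))
      = (- of_real b - t) / (of_real (2 * a) :: complex)" for t
    using cancel[of "- t"] by simp
  have y: "y = (k * a, k * b, k * c)"
    by (simp add: k(2) x)
  show "(case x of (a, b, c) \<Rightarrow>
          {(- of_real b + \<i> * of_real (sqrt (4 * a * c - b\<^sup>2))) / of_real (2 * a),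
           (- of_real b - \<i> * of_real (sqrt (4 * a * c - b\<^sup>2))) / (of_real (2 * a) :: complex)})
      = (case y of (a, b, c) \<Rightarrow>
          {(- of_real b + \<i> * of_real (sqrt (4 * a * c - b\<^sup>2))) / of_real (2 * a),
           (- of_real b - \<i> * of_real (sqrt (4 * a * c - b\<^sup>2))) / of_real (2 * a)})"
  proof (cases "k \<ge> 0")
    case True
    then show ?thesis
      by (simp only: x y prod.case s' abs_of_nonneg cancel cancel' s_def[symmetric])
  next
    case False
    then have "of_real \<bar>k\<bar> * s = - (of_real k * s)"
      by simp
    then show ?thesis
      by (simp only: x y prod.case s' add_uminus_conv_diff diff_minus_eq_add cancel cancel'
          s_def[symmetric] insert_commute)
  qed
qed

definition upper_root :: "rp2 \<Rightarrow> complex" where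
  "upper_root p = (THE z. z \<in> quadratic_formula p \<and> Im z > 0)"

definition klein_disk :: "(real \<times> real) set" where
  "klein_disk = {(u, v). u\<^sup>2 + v\<^sup>2 < 1}"

fun klein_dist :: "real \<times> real \<Rightarrow> real \<times> real \<Rightarrow> real" where
  "klein_dist (u1, v1) (u2, v2) =
     arcosh ((1 - u1 * u2 - v1 * v2) / sqrt ((1 - u1\<^sup>2 - v1\<^sup>2) * (1 - u2\<^sup>2 - v2\<^sup>2)))"

definition upper_half_plane :: "complex set" where
  "upper_half_plane = {z. Im z > 0}"

definition uhp_dist :: "complex \<Rightarrow> complex \<Rightarrow> real" where
  "uhp_dist z1 z2 =
     arcosh (1 + ((Re z2 - Re z1)\<^sup>2 + (Im z2 - Im z1)\<^sup>2) / (2 * Im z1 * Im z2))"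

definition isometry_between ::
  "'a set \<Rightarrow> ('a \<Rightarrow> 'a \<Rightarrow> real) \<Rightarrow> 'b set \<Rightarrow> ('b \<Rightarrow> 'b \<Rightarrow> real) \<Rightarrow> ('a \<Rightarrow> 'b) \<Rightarrow> bool" where
  "isometry_between X d Y e f \<longleftrightarrow>
     bij_betw f X Y \<and> (\<forall>p\<in>X. \<forall>q\<in>X. e (f p) (f q) = d p q)"

end

theory Submission
  imports Defs
begin

text \<open>
  The change of coordinates turns the discriminant \<open>4 * a * c - b\<^sup>2\<close> into the quadratic form
  \<open>w\<^sup>2 - u\<^sup>2 - v\<^sup>2\<close>, so the definite quadratics correspond to the disk and the roots take the
  stated form. A root \<open>z\<close> satisfies \<open>\<bar>z\<bar>\<^sup>2 = c / a = (1 - u) / (1 + u)\<close>. This determines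
  \<open>u\<close>, and then \<open>v\<close>, from \<open>z\<close>; it also makes the arguments of the two \<open>arcosh\<close> agree.
\<close>

section \<open>The change of coordinates on the projective plane\<close>

lemma hpoint_scale:
  assumes "(a, b, c) \<noteq> (0, 0, 0)" "k \<noteq> 0"
  shows "hpoint (k * a) (k * b) (k * c) = hpoint a b c"
  unfolding hpoint_def
  by (rule sym, rule Quotient3_rel_abs[OF Quotient3_rp2])
     (use assms in \<open>auto simp: proj_rel_def zero_prod_def\<close>)

text \<open>The quotient is partial, so the \<open>abs_eq\<close> rules of lifted maps ask for
  \<open>proj_rel x x\<close>, which excludes exactly the zero triple.\<close>

lemma proj_rel_refl: "x \<noteq> 0 \<Longrightarrow> proj_rel x x"
  by (auto simp: proj_rel_def intro!: exI[of _ 1])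

lemma coord_change_hpoint:
  assumes "(u, v, w) \<noteq> (0, 0, 0)"
  shows "coord_change (hpoint u v w) = hpoint ((w + u) / 2) v ((w - u) / 2)"
  using assms coord_change.abs_eq[OF proj_rel_refl, of "(u, v, w)"]
  by (simp add: hpoint_def zero_prod_def)

lemma quadratic_formula_hpoint:
  assumes "(a, b, c) \<noteq> (0, 0, 0)"
  shows "quadratic_formula (hpoint a b c) =
    {(- of_real b + \<i> * of_real (sqrt (4 * a * c - b\<^sup>2))) / of_real (2 * a),
     (- of_real b - \<i> * of_real (sqrt (4 * a * c - b\<^sup>2))) / of_real (2 * a)}"
  using assms quadratic_formula.abs_eq[OF proj_rel_refl, of "(a, b, c)"]
  by (simp add: hpoint_def zero_prod_def)

text \<open>Solving \<open>a = (w + u) / 2\<close>, \<open>c = (w - u) / 2\<close> gives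
  \<open>u = a - c\<close>, \<open>w = a + c\<close>.\<close>

lift_definition coord_change_inv :: "rp2 \<Rightarrow> rp2" is
  "\<lambda>(a, b, c). (a - c, b, a + c)"
  by (auto simp: proj_rel_def zero_prod_def algebra_simps)

lemma bij_coord_change: "bij coord_change"
proof (rule o_bij)
  show "coord_change_inv \<circ> coord_change = id"
    unfolding fun_eq_iff comp_def id_def
    by transfer (auto simp: proj_rel_def zero_prod_def field_simps intro!: exI[of _ 1])
  show "coord_change \<circ> coord_change_inv = id"
    unfolding fun_eq_iff comp_def id_def
    by transfer (auto simp: proj_rel_def zero_prod_def field_simps intro!: exI[of _ 1])
qed

lemma coord_change_image_disk:
  "coord_change ` {hpoint u v 1 | u v. u\<^sup>2 + v\<^sup>2 < 1} = {hpoint a b c | a b c. b\<^sup>2 < 4 * a * c}"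
proof (intro equalityI subsetI)
  fix p assume "p \<in> coord_change ` {hpoint u v 1 | u v. u\<^sup>2 + v\<^sup>2 < 1}"
  then obtain u v where uv: "u\<^sup>2 + v\<^sup>2 < 1" and p: "p = coord_change (hpoint u v 1)"
    by blast
  have "4 * ((1 + u) / 2) * ((1 - u) / 2) = 1 - u\<^sup>2"
    by (simp add: power2_eq_square field_simps)
  then have "v\<^sup>2 < 4 * ((1 + u) / 2) * ((1 - u) / 2)"
    using uv by linarith
  then show "p \<in> {hpoint a b c | a b c. b\<^sup>2 < 4 * a * c}"
    unfolding p by (subst coord_change_hpoint, simp) blast
next
  fix p assume "p \<in> {hpoint a b c | a b c. b\<^sup>2 < 4 * a * c}"
  then obtain a b c where abc: "b\<^sup>2 < 4 * a * c" and p: "p = hpoint a b c"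
    by blast
  \<comment> \<open>Since \<open>4 * a * c\<close> is the difference of the squares of
    \<open>a + c\<close> and \<open>a - c\<close>, the discriminant condition is the cone condition
    on the preimage \<open>[a - c : b : a + c]\<close>. It forces the last coordinate to be
    nonzero.\<close>
  have sq: "(a - c)\<^sup>2 + b\<^sup>2 < (a + c)\<^sup>2"
    using abc by (simp add: power2_eq_square algebra_simps)
  then have ac: "a + c \<noteq> 0"
    using not_sum_power2_lt_zero[of "a - c" b] by auto
  \<comment> \<open>The preimage, rescaled to have last coordinate 1.\<close>
  define u v where "u = (a - c) / (a + c)" and "v = b / (a + c)"
  have "u\<^sup>2 + v\<^sup>2 = ((a - c)\<^sup>2 + b\<^sup>2) / (a + c)\<^sup>2"
    by (simp add: u_def v_def power_divide add_divide_distrib)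
  then have uv: "u\<^sup>2 + v\<^sup>2 < 1"
    using sq ac by simp
  have "coord_change (hpoint u v 1) = hpoint ((1 + u) / 2) v ((1 - u) / 2)"
    by (simp add: coord_change_hpoint)
  also have "\<dots> = hpoint (1 / (a + c) * a) (1 / (a + c) * b) (1 / (a + c) * c)"
    using ac by (intro arg_cong3[of _ _ _ _ _ _ hpoint]) (simp_all add: u_def v_def field_simps)
  also have "\<dots> = p"
    unfolding p by (rule hpoint_scale) (use ac in auto)
  finally show "p \<in> coord_change ` {hpoint u v 1 | u v. u\<^sup>2 + v\<^sup>2 < 1}"
    using uv by blast
qed

section \<open>The roots in Klein coordinates\<close>

lemma quadratic_formula_klein:
  "quadratic_formula (coord_change (hpoint u v 1)) =
    {(- of_real v + \<i> * of_real (sqrt (1 - u\<^sup>2 - v\<^sup>2))) / of_real (1 + u),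
     (- of_real v - \<i> * of_real (sqrt (1 - u\<^sup>2 - v\<^sup>2))) / of_real (1 + u)}"
proof -
  have "4 * ((1 + u) / 2) * ((1 - u) / 2) - v\<^sup>2 = 1 - u\<^sup>2 - v\<^sup>2"
    by (simp add: power2_eq_square field_simps)
  moreover have "2 * ((1 + u) / 2) = 1 + u"
    by simp
  \<comment> \<open>The outer two entries sum to 1, so they cannot both vanish.\<close>
  moreover have "((1 + u) / 2, v, (1 - u) / 2) \<noteq> (0, 0, 0)"
    by auto
  note quadratic_formula_hpoint[OF this]
  ultimately show ?thesis
    by (subst coord_change_hpoint, simp) (simp only:)
qed

text \<open>The root with positive imaginary part on the disk, split into real and imaginary parts
  so that later computations stay real.\<close>

definition klein_to_uhp :: "real \<times> real \<Rightarrow> complex" where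
  "klein_to_uhp = (\<lambda>(u, v). Complex (- v / (1 + u)) (sqrt (1 - u\<^sup>2 - v\<^sup>2) / (1 + u)))"

lemma klein_to_uhp_eq:
  "klein_to_uhp (u, v) = (- of_real v + \<i> * of_real (sqrt (1 - u\<^sup>2 - v\<^sup>2))) / of_real (1 + u)"
  by (simp only: complex_eq_iff Re_divide_of_real Im_divide_of_real) (simp add: klein_to_uhp_def)

lemma klein_disk_bounds:
  assumes "u\<^sup>2 + v\<^sup>2 < (1 :: real)"
  shows "1 + u > 0" "1 - u > 0" "1 - u\<^sup>2 - v\<^sup>2 > 0"
proof -
  have "u\<^sup>2 < 1"
    using assms zero_le_power2[of v] by linarith
  then have "\<bar>u\<bar> < 1"
    by (simp add: abs_square_less_1)
  then show "1 + u > 0" "1 - u > 0"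
    by auto
  show "1 - u\<^sup>2 - v\<^sup>2 > 0"
    using assms by simp
qed

text \<open>The two roots are complex conjugates, and on the disk their imaginary parts are nonzero
  because \<open>1 + u\<close> and the radicand are positive. Hence exactly one root lies in the
  upper half plane and the definite description is justified.\<close>

lemma upper_root_klein:
  assumes "u\<^sup>2 + v\<^sup>2 < 1"
  shows "upper_root (coord_change (hpoint u v 1)) = klein_to_uhp (u, v)"
  unfolding upper_root_def
proof (rule the_equality)
  have pos: "sqrt (1 - u\<^sup>2 - v\<^sup>2) / (1 + u) > 0"
    using klein_disk_bounds[OF assms] by simp
  then show "klein_to_uhp (u, v) \<in> quadratic_formula (coord_change (hpoint u v 1)) \<and>
      Im (klein_to_uhp (u, v)) > 0"
    unfolding quadratic_formula_klein klein_to_uhp_eq[symmetric] by (simp add: klein_to_uhp_def)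
  fix z assume z: "z \<in> quadratic_formula (coord_change (hpoint u v 1)) \<and> Im z > 0"
  have "Im ((- of_real v - \<i> * of_real (sqrt (1 - u\<^sup>2 - v\<^sup>2))) / of_real (1 + u))
      = - (sqrt (1 - u\<^sup>2 - v\<^sup>2) / (1 + u))"
    by (simp only: Im_divide_of_real) simp
  then show "z = klein_to_uhp (u, v)"
    using z pos unfolding quadratic_formula_klein klein_to_uhp_eq[symmetric] by auto
qed

text \<open>The square of \<open>v\<close> cancels against the one under the root, and a factor
  \<open>1 + u\<close> then cancels from the fraction.\<close>

lemma norm_klein_to_uhp:
  assumes "u\<^sup>2 + v\<^sup>2 < 1"
  shows "(Re (klein_to_uhp (u, v)))\<^sup>2 + (Im (klein_to_uhp (u, v)))\<^sup>2 = (1 - u) / (1 + u)"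
proof -
  have "(Re (klein_to_uhp (u, v)))\<^sup>2 + (Im (klein_to_uhp (u, v)))\<^sup>2
      = (1 - u\<^sup>2) / (1 + u)\<^sup>2"
    using klein_disk_bounds[OF assms]
    by (simp add: klein_to_uhp_def power_divide flip: add_divide_distrib)
  also have "\<dots> = ((1 - u) * (1 + u)) / ((1 + u) * (1 + u))"
    by (simp add: power2_eq_square algebra_simps)
  also have "\<dots> = (1 - u) / (1 + u)"
    using klein_disk_bounds[OF assms] by simp
  finally show ?thesis .
qed

section \<open>Bijectivity and preservation of distance\<close>

lemma bij_betw_klein_to_uhp: "bij_betw klein_to_uhp klein_disk upper_half_plane"
proof -
  \<comment> \<open>The inverse map: solve \<open>n = (1 - u) / (1 + u)\<close> for
    \<open>u\<close>, so that \<open>1 + u = 2 / (1 + n)\<close>; then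
    \<open>v = - Re z * (1 + u)\<close>.\<close>
  define g :: "complex \<Rightarrow> real \<times> real" where
    "g z = (let n = (Re z)\<^sup>2 + (Im z)\<^sup>2 in ((1 - n) / (1 + n), - 2 * Re z / (1 + n)))" for z
  have into: "klein_to_uhp (u, v) \<in> upper_half_plane" if "(u, v) \<in> klein_disk" for u v
    using that klein_disk_bounds[of u v]
    by (simp add: klein_disk_def upper_half_plane_def klein_to_uhp_def)
  have gf: "g (klein_to_uhp (u, v)) = (u, v)" if "(u, v) \<in> klein_disk" for u v
  proof -
    have uv: "u\<^sup>2 + v\<^sup>2 < 1"
      using that by (simp add: klein_disk_def)
    have pos: "1 + u > 0"
      by (rule klein_disk_bounds[OF uv])
    then have "1 + (1 - u) / (1 + u) = 2 / (1 + u)" "1 - (1 - u) / (1 + u) = 2 * u / (1 + u)"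
      by (simp_all add: field_simps)
    then show ?thesis
      using pos by (simp add: g_def Let_def norm_klein_to_uhp[OF uv])
        (simp add: klein_to_uhp_def)
  qed
  have fg: "g z \<in> klein_disk \<and> klein_to_uhp (g z) = z" if "z \<in> upper_half_plane" for z
  proof -
    define x y n where "x = Re z" and "y = Im z" and "n = x\<^sup>2 + y\<^sup>2"
    define u v where "u = (1 - n) / (1 + n)" and "v = - 2 * x / (1 + n)"
    have y: "y > 0"
      using that by (simp add: upper_half_plane_def y_def)
    have n: "1 + n > 0"
      by (simp add: n_def add_pos_nonneg)
    have g: "g z = (u, v)"
      by (simp add: g_def Let_def u_def v_def n_def x_def y_def)
    have u: "1 + u = 2 / (1 + n)"
      using n by (simp add: u_def field_simps)
    have "1 - u\<^sup>2 - v\<^sup>2 = ((1 + n)\<^sup>2 - (1 - n)\<^sup>2 - (2 * x)\<^sup>2) / (1 + n)\<^sup>2"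
      using n by (simp add: u_def v_def power_divide divide_simps)
    \<comment> \<open>The first two squares differ by \<open>4 * n\<close>, and removing the part
      from \<open>x\<close> leaves the part from \<open>y\<close>.\<close>
    also have "(1 + n)\<^sup>2 - (1 - n)\<^sup>2 - (2 * x)\<^sup>2 = (2 * y)\<^sup>2"
      by (simp add: n_def power2_eq_square algebra_simps)
    finally have s: "1 - u\<^sup>2 - v\<^sup>2 = (2 * y / (1 + n))\<^sup>2"
      by (simp add: power_divide)
    have "2 * y / (1 + n) > 0"
      using y n by simp
    \<comment> \<open>The square root returns an absolute value; positivity of \<open>y\<close>
      removes it, so the recovered point is \<open>z\<close> and not its conjugate.\<close>
    then have s': "sqrt (1 - u\<^sup>2 - v\<^sup>2) = 2 * y / (1 + n)" and "1 - u\<^sup>2 - v\<^sup>2 > 0"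
      unfolding s by (simp_all only: real_sqrt_abs abs_of_pos zero_less_power)
    moreover have "- v / (1 + u) = x" "(2 * y / (1 + n)) / (1 + u) = y"
      using n unfolding u by (simp_all add: v_def)
    ultimately show ?thesis
      unfolding g klein_to_uhp_def klein_disk_def prod.case s'
      by (simp add: x_def y_def)
  qed
  show ?thesis
    by (rule bij_betw_byWitness[where f' = g]) (use into gf fg in auto)
qed

lemma uhp_dist_klein_to_uhp:
  assumes "p \<in> klein_disk" "q \<in> klein_disk"
  shows "uhp_dist (klein_to_uhp p) (klein_to_uhp q) = klein_dist p q"
proof -
  obtain u1 v1 u2 v2 where pq: "p = (u1, v1)" "q = (u2, v2)"
    by (cases p, cases q) auto
  have uv: "u1\<^sup>2 + v1\<^sup>2 < 1" "u2\<^sup>2 + v2\<^sup>2 < 1"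
    using assms by (auto simp: pq klein_disk_def)
  define s1 s2 where "s1 = sqrt (1 - u1\<^sup>2 - v1\<^sup>2)" and "s2 = sqrt (1 - u2\<^sup>2 - v2\<^sup>2)"
  define x1 y1 x2 y2 where
    "x1 = - v1 / (1 + u1)" and "y1 = s1 / (1 + u1)" and
    "x2 = - v2 / (1 + u2)" and "y2 = s2 / (1 + u2)"
  have z: "klein_to_uhp p = Complex x1 y1" "klein_to_uhp q = Complex x2 y2"
    by (simp_all add: klein_to_uhp_def pq x1_def y1_def x2_def y2_def s1_def s2_def)
  have pos: "1 + u1 > 0" "1 + u2 > 0" "s1 > 0" "s2 > 0"
    using klein_disk_bounds[OF uv(1)] klein_disk_bounds[OF uv(2)] by (simp_all add: s1_def s2_def)
  have n: "x1\<^sup>2 + y1\<^sup>2 = (1 - u1) / (1 + u1)" "x2\<^sup>2 + y2\<^sup>2 = (1 - u2) / (1 + u2)"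
    using norm_klein_to_uhp[OF uv(1)] norm_klein_to_uhp[OF uv(2)] z by (simp_all add: pq)
  \<comment> \<open>Over the common denominator, the summand 1 cancels the cross term
    \<open>- 2 * y1 * y2\<close>, leaving only squared norms and \<open>x1 * x2\<close>.\<close>
  have "y1 \<noteq> 0" "y2 \<noteq> 0"
    using pos by (simp_all add: y1_def y2_def)
  then have "1 + ((x2 - x1)\<^sup>2 + (y2 - y1)\<^sup>2) / (2 * y1 * y2)
      = ((x1\<^sup>2 + y1\<^sup>2) + (x2\<^sup>2 + y2\<^sup>2) - 2 * x1 * x2) / (2 * y1 * y2)"
    by (simp add: field_simps power2_eq_square)
  also have "\<dots> = ((1 - u1) / (1 + u1) + (1 - u2) / (1 + u2) - 2 * x1 * x2) / (2 * y1 * y2)"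
    unfolding n ..
  \<comment> \<open>Multiply numerator and denominator by \<open>(1 + u1) * (1 + u2)\<close>: the
    terms linear in \<open>u1\<close> and \<open>u2\<close> cancel, and a factor 2 drops
    out.\<close>
  also have "\<dots> = (1 - u1 * u2 - v1 * v2) / (s1 * s2)"
    using pos by (simp add: x1_def x2_def y1_def y2_def divide_simps) (simp add: algebra_simps)
  finally show ?thesis
    unfolding uhp_dist_def z by (simp add: pq s1_def s2_def real_sqrt_mult)
qed

theorem corollary4p10:
  shows "bij coord_change \<and>
    coord_change ` {hpoint u v 1 | u v. u\<^sup>2 + v\<^sup>2 < 1} = {hpoint a b c | a b c. b\<^sup>2 < 4 * a * c} \<and>
    (\<forall>u v. u\<^sup>2 + v\<^sup>2 < 1 \<longrightarrow>
      quadratic_formula (coord_change (hpoint u v 1)) =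
        {(- of_real v + \<i> * of_real (sqrt (1 - u\<^sup>2 - v\<^sup>2))) / of_real (1 + u),
         (- of_real v - \<i> * of_real (sqrt (1 - u\<^sup>2 - v\<^sup>2))) / of_real (1 + u)} \<and>
      upper_root (coord_change (hpoint u v 1)) =
        (- of_real v + \<i> * of_real (sqrt (1 - u\<^sup>2 - v\<^sup>2))) / of_real (1 + u)) \<and>
    isometry_between klein_disk klein_dist upper_half_plane uhp_dist
      (\<lambda>(u, v). upper_root (coord_change (hpoint u v 1)))"
proof (intro conjI allI impI)
  show "bij coord_change"
    by (rule bij_coord_change)
  show "coord_change ` {hpoint u v 1 | u v. u\<^sup>2 + v\<^sup>2 < 1} = {hpoint a b c | a b c. b\<^sup>2 < 4 * a * c}"
    by (rule coord_change_image_disk)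
next
  fix u v :: real
  assume "u\<^sup>2 + v\<^sup>2 < 1"
  show "quadratic_formula (coord_change (hpoint u v 1)) =
      {(- of_real v + \<i> * of_real (sqrt (1 - u\<^sup>2 - v\<^sup>2))) / of_real (1 + u),
       (- of_real v - \<i> * of_real (sqrt (1 - u\<^sup>2 - v\<^sup>2))) / of_real (1 + u)}"
    by (rule quadratic_formula_klein)
  show "upper_root (coord_change (hpoint u v 1)) =
      (- of_real v + \<i> * of_real (sqrt (1 - u\<^sup>2 - v\<^sup>2))) / of_real (1 + u)"
    using \<open>u\<^sup>2 + v\<^sup>2 < 1\<close> by (simp only: upper_root_klein klein_to_uhp_eq)
next
  \<comment> \<open>Bijectivity and the distance identity only involve values on the disk, so
    agreement there transfers both from \<open>klein_to_uhp\<close>.\<close>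
  have eq: "(\<lambda>(u, v). upper_root (coord_change (hpoint u v 1))) p = klein_to_uhp p"
    if "p \<in> klein_disk" for p
    using that by (auto simp: klein_disk_def upper_root_klein)
  then have "bij_betw (\<lambda>(u, v). upper_root (coord_change (hpoint u v 1))) klein_disk upper_half_plane"
    using bij_betw_klein_to_uhp by (subst bij_betw_cong) auto
  then show "isometry_between klein_disk klein_dist upper_half_plane uhp_dist
      (\<lambda>(u, v). upper_root (coord_change (hpoint u v 1)))"
    unfolding isometry_between_def by (metis eq uhp_dist_klein_to_uhp)
qed

end
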